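(* Let $P\subset\mathbb{R}^D$ be an $(\epsilon_1,\epsilon_2)$-significant instance of $k$-means clustering with $z$ outliers, $|P|=n$, let $\eta,\delta,\xi\in(0,1)$, and assume $t=\eta(1-\delta)\frac{\epsilon_1}{\epsilon_2}>1$. Consider the following algorithm: (1) sample a set $S$ of $\max\{\frac{3k}{\delta^2\epsilon_1}\log\frac{2k}{\eta},\frac{k}{2\xi^2\epsilon_1(1-\delta)}\log\frac{2k}{\eta}\}$ points uniformly at random from $P$; (2) let $z'=\frac{1}{\eta}\frac{\epsilon_2}{k}|S|$ and solve $k$-means clustering with $z'$ outliers on $S$ using any $c$-approximation algorithm with $c\ge1$; output the set $H$ of $k$ returned centers. Then with probability at least $(1-\eta)^3$, $$\Delta^{-z}_2(P,H)\le\alpha\,\Delta^{-z}_2(P,O^* )+\beta\,\xi\,\mathcal{L}^2,$$ where $\alpha=2+(4+4c)\frac{t}{t-1}\frac{1+\delta}{1-\delta}$ and $\beta=(4+4c)\frac{t}{t-1}\frac{1+\delta}{1-\delta}$.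
   Context: For finite $H\subset\mathbb{R}^D$, $dist(p,H)=\min_{q\in H}\|p-q\|$; for a finite point set $Q$ and integer $0<w<|Q|$, $\Delta^{-w}_2(Q,H)=\min\{\frac{1}{|Q'|}\sum_{p\in Q'}dist(p,H)^2: Q'\subset Q,|Q'|=|Q|-w\}$. The $k$-means clustering with $w$ outliers problem on $Q$ asks for $k$ centers in $\mathbb{R}^D$ minimizing $\Delta^{-w}_2(Q,\cdot)$; a $c$-approximation returns $k$ centers whose value is at most $c$ times the optimum. $P_{opt}\subset P$, $|P_{opt}|=n-z$, is the set of inliers of an optimal solution for $P$ with $z$ outliers, and $C^*_1,\dots,C^*_k$ are the optimal clusters forming $P_{opt}$; $o^*_j$ is the mean of $C^*_j$, $O^*=\{o^*_1,\dots,o^*_k\}$; $\mathcal{L}=\max_j\max_{p,q\in C^*_j}\|p-q\|$. The instance is $(\epsilon_1,\epsilon_2)$-significant ($\epsilon_1,\epsilon_2>0$) if $\min_j|C^*_j|\ge\frac{\epsilon_1}{k}n$ and $z=\frac{\epsilon_2}{k}n$. Sampling uniformly at random means each sample point is drawn independently and uniformly from $P$ ($S$ regarded as a multiset). *)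

theory Defs
  imports "HOL-Probability.Probability" "HOL-Library.Multiset"
begin

definition dist_set :: "'a::euclidean_space \<Rightarrow> 'a set \<Rightarrow> real" where
  "dist_set p H = Min ((\<lambda>q. norm (p - q)) ` H)"

definition trimmed_cost :: "'a::euclidean_space multiset \<Rightarrow> nat \<Rightarrow> 'a set \<Rightarrow> real" where
  "trimmed_cost Q w H =
     Min {(1 / real (size Q')) * (\<Sum>p\<in>#Q'. (dist_set p H)\<^sup>2) | Q'. Q' \<subseteq># Q \<and> size Q' = size Q - w}"

definition kmeans_out_opt :: "'a::euclidean_space multiset \<Rightarrow> nat \<Rightarrow> nat \<Rightarrow> real" where
  "kmeans_out_opt Q w k = Inf {trimmed_cost Q w H | H. finite H \<and> card H = k}"

definition is_c_approx :: "real \<Rightarrow> 'a::euclidean_space multiset \<Rightarrow> nat \<Rightarrow> nat \<Rightarrow> 'a set \<Rightarrow> bool" where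
  "is_c_approx c Q w k H \<longleftrightarrow> finite H \<and> card H = k \<and> trimmed_cost Q w H \<le> c * kmeans_out_opt Q w k"

definition mean :: "'a::euclidean_space set \<Rightarrow> 'a" where
  "mean C = (1 / real (card C)) *\<^sub>R (\<Sum>p\<in>C. p)"

end

theory Submission
  imports Defs
begin

text \<open>
  Let \<open>F\<close> be the event that the sample contains at most \<open>z'\<close> outliers; Markov's inequality gives it
  probability at least \<open>1 - \<eta>\<close>. Given \<open>F\<close>, two further properties fail with probability at most
  \<open>\<eta> / 2\<close> each: every cluster \<open>C j\<close> receives at least a \<open>1 - \<delta>\<close> fraction of its expected number of
  samples, and the sum over the sampled inliers of the squared distance to the own cluster mean is at most
  \<open>2 (1 + \<delta>) (m / n) (V + \<xi> L\<^sup>2 (n - z))\<close>, where \<open>V\<close> is the optimal sum over \<open>P_opt\<close>. Both are Chernoff bounds;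
  they survive the conditioning on \<open>F\<close>, since the exponential weights involved are no larger on average over
  the inliers than the bound used for them. This gives the probability \<open>(1 - \<eta>)\<^sup>2\<close>.

  Under these properties at least \<open>(1 - \<delta>) (1 - 1 / t) (m / n) |C j|\<close> samples of each \<open>C j\<close> are inliers of
  the solution \<open>H\<close> on the sample. Averaging \<open>dist (o j, H)\<^sup>2 \<le> 2 |s - o j|\<^sup>2 + 2 dist (s, H)\<^sup>2\<close> over them and
  comparing the cost of \<open>H\<close> on the sample with that of the optimal means bounds the weighted sum of the
  \<open>dist (o j, H)\<^sup>2\<close>. The factor 2 in the second property is paid for by the identity
  \<open>\<Sum> |p - h|\<^sup>2 = \<Sum> |p - o j|\<^sup>2 + |C j| |o j - h|\<^sup>2\<close>, which replaces the triangle inequality on \<open>C j\<close>.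
\<close>

section \<open>Uniform samples with few hits of a bad set\<close>

text \<open>Exposes the last draw. Expectations over samples are written as unnormalised sums over
  \<open>PiE {..<m} (\<lambda>_. P)\<close>, and this is their recursion in
  \<open>m\<close>.\<close>

lemma sum_PiE_lessThan_Suc:
  fixes F :: "(nat \<Rightarrow> 'b) \<Rightarrow> real"
  assumes "finite P"
  shows "(\<Sum>f\<in>PiE {..<Suc m} (\<lambda>_. P). F f) = (\<Sum>x\<in>P. \<Sum>f\<in>PiE {..<m} (\<lambda>_. P). F (f(m := x)))"
proof -
  have "(\<Sum>f\<in>PiE {..<Suc m} (\<lambda>_. P). F f) =
        (\<Sum>f\<in>(\<lambda>(y, g). g(m := y)) ` (P \<times> PiE {..<m} (\<lambda>_. P)). F f)"
    by (simp add: lessThan_Suc PiE_insert_eq)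
  also have "\<dots> = (\<Sum>(x, f)\<in>P \<times> PiE {..<m} (\<lambda>_. P). F (f(m := x)))"
    using inj_combinator[of m "{..<m}" "\<lambda>_. P"] by (subst sum.reindex) (simp_all add: case_prod_unfold)
  also have "\<dots> = (\<Sum>x\<in>P. \<Sum>f\<in>PiE {..<m} (\<lambda>_. P). F (f(m := x)))"
    by (simp add: sum.cartesian_product)
  finally show ?thesis .
qed

text \<open>Counts sample positions, not distinct points, because the sample is a multiset.\<close>

definition hits :: "nat \<Rightarrow> 'b set \<Rightarrow> (nat \<Rightarrow> 'b) \<Rightarrow> nat" where
  "hits m B f = (\<Sum>i<m. of_bool (f i \<in> B))"

lemma hits_upd [simp]: "hits (Suc m) B (f(m := x)) = hits m B f + of_bool (x \<in> B)"
  unfolding hits_def by (simp add: sum.lessThan_Suc)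

lemma prod_lessThan_Suc_upd:
  fixes g :: "'b \<Rightarrow> real"
  shows "(\<Prod>i<Suc m. g ((f(m := x)) i)) = (\<Prod>i<m. g (f i)) * g x"
  by (simp add: prod.lessThan_Suc)

text \<open>Conditioning on few hits of \<open>B\<close> does not hurt an exponential moment bound that already holds
  for a uniform point of \<open>P\<close> and for a uniform point of \<open>P - B\<close>.\<close>

lemma sum_antimono_hits_prod_le:
  fixes g :: "'b \<Rightarrow> real" and \<Phi> :: "nat \<Rightarrow> real"
  assumes "finite P" "B \<subseteq> P" "antimono \<Phi>" "\<And>x. \<Phi> x \<ge> 0" "\<And>x. x \<in> P \<Longrightarrow> g x \<ge> 0" "w \<ge> 0"
    and gin: "(\<Sum>x\<in>P - B. g x) \<le> w * real (card (P - B))"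
    and gall: "(\<Sum>x\<in>P. g x) \<le> w * real (card P)"
  shows "(\<Sum>f\<in>PiE {..<m} (\<lambda>_. P). \<Phi> (hits m B f) * (\<Prod>i<m. g (f i)))
         \<le> w ^ m * (\<Sum>f\<in>PiE {..<m} (\<lambda>_. P). \<Phi> (hits m B f))"
  using assms(3,4)
proof (induction m arbitrary: \<Phi>)
  case 0
  then show ?case by simp
next
  case (Suc m)
  define T where "T \<Phi> = (\<Sum>f\<in>PiE {..<m} (\<lambda>_. P). \<Phi> (hits m B f) * (\<Prod>i<m. g (f i)))"
    for \<Phi> :: "nat \<Rightarrow> real"
  define U where "U \<Phi> = (\<Sum>f\<in>PiE {..<m} (\<lambda>_. P). \<Phi> (hits m B f))" for \<Phi> :: "nat \<Rightarrow> real"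
  \<comment> \<open>The weight seen by the first \<open>m\<close> draws once the last draw has
    landed in \<open>B\<close>; the induction keeps \<open>\<Phi>\<close> arbitrary in order to
    cover it.\<close>
  define \<Psi> where "\<Psi> x = \<Phi> (Suc x)" for x
  have \<Psi>: "antimono \<Psi>" "\<And>x. \<Psi> x \<ge> 0" "\<And>x. \<Psi> x \<le> \<Phi> x"
    using Suc.prems by (auto simp: \<Psi>_def antimono_def)
  have fin: "finite B" using finite_subset[OF assms(2,1)] .
  have split: "(\<Sum>x\<in>P. h x) = (\<Sum>x\<in>P - B. h x) + (\<Sum>x\<in>B. h x)" for h :: "'b \<Rightarrow> real"
    using sum.subset_diff[OF assms(2,1), of h] by simp
  define a where "a = (\<Sum>x\<in>P - B. g x)"
  define b where "b = (\<Sum>x\<in>B. g x)"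
  have IH: "T \<Phi> \<le> w ^ m * U \<Phi>" "T \<Psi> \<le> w ^ m * U \<Psi>"
    using Suc.IH[OF Suc.prems] Suc.IH[OF \<Psi>(1,2)] by (auto simp: T_def U_def)
  have prodnn: "f \<in> PiE {..<m} (\<lambda>_. P) \<Longrightarrow> (\<Prod>i<m. g (f i)) \<ge> 0" for f
    by (intro prod_nonneg) (auto intro!: assms(5))
  have T: "T \<Psi> \<ge> 0" "T \<Psi> \<le> T \<Phi>"
    unfolding T_def by (intro sum_nonneg mult_nonneg_nonneg \<Psi>(2) prodnn, assumption)
      (intro sum_mono mult_right_mono \<Psi>(3) prodnn, assumption)
  have "(\<Sum>f\<in>PiE {..<Suc m} (\<lambda>_. P). \<Phi> (hits (Suc m) B f) * (\<Prod>i<Suc m. g (f i)))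
     = (\<Sum>x\<in>P. \<Sum>f\<in>PiE {..<m} (\<lambda>_. P). \<Phi> (hits m B f + of_bool (x \<in> B)) * ((\<Prod>i<m. g (f i)) * g x))"
    using assms(1) by (subst sum_PiE_lessThan_Suc) (simp_all only: prod_lessThan_Suc_upd hits_upd)
  also have "\<dots> = (\<Sum>x\<in>P - B. g x * T \<Phi>) + (\<Sum>x\<in>B. g x * T \<Psi>)"
    unfolding split T_def \<Psi>_def
    by (intro arg_cong2[of _ _ _ _ "(+)"] sum.cong) (auto simp: sum_distrib_left algebra_simps)
  also have "\<dots> = a * T \<Phi> + b * T \<Psi>" by (simp add: a_def b_def sum_distrib_right)
  \<comment> \<open>Only \<open>a\<close> and \<open>a + b\<close> are controlled by the hypotheses,
    so the sum is regrouped around them; antimonotonicity makes the coefficient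
    \<open>T \<Phi> - T \<Psi>\<close> nonnegative.\<close>
  also have "\<dots> = a * (T \<Phi> - T \<Psi>) + (a + b) * T \<Psi>" by (simp add: algebra_simps)
  also have "\<dots> \<le> w * real (card (P - B)) * (T \<Phi> - T \<Psi>) + w * real (card P) * T \<Psi>"
    using gin gall T unfolding a_def b_def split[symmetric] by (intro add_mono mult_right_mono) auto
  also have "real (card P) = real (card (P - B)) + real (card B)"
    using assms(1,2) fin by (simp add: card_Diff_subset card_mono of_nat_diff)
  also have "w * real (card (P - B)) * (T \<Phi> - T \<Psi>) + w * (real (card (P - B)) + real (card B)) * T \<Psi>
      = w * (real (card (P - B)) * T \<Phi> + real (card B) * T \<Psi>)" by (simp add: algebra_simps)
  also have "\<dots> \<le> w * (real (card (P - B)) * (w ^ m * U \<Phi>) + real (card B) * (w ^ m * U \<Psi>))"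
    using assms(6) IH by (intro mult_left_mono add_mono) auto
  also have "\<dots> = w ^ Suc m * (real (card (P - B)) * U \<Phi> + real (card B) * U \<Psi>)"
    by (simp add: algebra_simps)
  also have "real (card (P - B)) * U \<Phi> + real (card B) * U \<Psi>
      = (\<Sum>x\<in>P. \<Sum>f\<in>PiE {..<m} (\<lambda>_. P). \<Phi> (hits m B f + of_bool (x \<in> B)))"
    unfolding split U_def \<Psi>_def by (simp add: algebra_simps)
  also have "\<dots> = (\<Sum>f\<in>PiE {..<Suc m} (\<lambda>_. P). \<Phi> (hits (Suc m) B f))"
    using assms(1) by (subst sum_PiE_lessThan_Suc) simp_all
  finally show ?case .
qed

text \<open>Exponential Markov inequality on the event of at most \<open>r\<close> hits: on a bad
  sample \<open>\<kappa>\<close> times the product of the weights is at least 1, and the indicator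
  of the event is an antimonotone \<open>\<Phi>\<close> of the hit count.\<close>

lemma card_few_hits_bad_le:
  fixes g :: "'b \<Rightarrow> real" and bad :: "(nat \<Rightarrow> 'b) \<Rightarrow> bool"
  assumes "finite P" "B \<subseteq> P" "\<And>x. x \<in> P \<Longrightarrow> g x \<ge> 0" "w \<ge> 0"
    and "(\<Sum>x\<in>P - B. g x) \<le> w * real (card (P - B))" "(\<Sum>x\<in>P. g x) \<le> w * real (card P)"
    and bad: "\<And>f. f \<in> PiE {..<m} (\<lambda>_. P) \<Longrightarrow> bad f \<Longrightarrow> 1 \<le> \<kappa> * (\<Prod>i<m. g (f i))"
    and \<kappa>: "\<kappa> \<ge> 0" "\<kappa> * w ^ m \<le> e"
  shows "real (card {f \<in> PiE {..<m} (\<lambda>_. P). hits m B f \<le> r \<and> bad f})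
         \<le> e * real (card {f \<in> PiE {..<m} (\<lambda>_. P). hits m B f \<le> r})"
proof -
  let ?\<Omega> = "PiE {..<m} (\<lambda>_. P)"
  define \<Phi> :: "nat \<Rightarrow> real" where "\<Phi> x = of_bool (x \<le> r)" for x
  have fin: "finite ?\<Omega>" using assms(1) by (intro finite_PiE) auto
  have card_eq: "real (card {f \<in> ?\<Omega>. Q f}) = (\<Sum>f\<in>?\<Omega>. of_bool (Q f))" for Q
    using fin by (simp add: Int_def)
  have "(\<Sum>f\<in>?\<Omega>. of_bool (hits m B f \<le> r \<and> bad f)) \<le> (\<Sum>f\<in>?\<Omega>. \<kappa> * (\<Phi> (hits m B f) * (\<Prod>i<m. g (f i))))"
  proof (rule sum_mono)
    fix f assume f: "f \<in> ?\<Omega>"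
    have nn: "(\<Prod>i<m. g (f i)) \<ge> 0"
      by (intro prod_nonneg) (use f in \<open>auto intro!: assms(3)\<close>)
    then show "of_bool (hits m B f \<le> r \<and> bad f) \<le> \<kappa> * (\<Phi> (hits m B f) * (\<Prod>i<m. g (f i)))"
      using bad[OF f] \<kappa> by (auto simp: \<Phi>_def)
  qed
  also have "\<dots> = \<kappa> * (\<Sum>f\<in>?\<Omega>. \<Phi> (hits m B f) * (\<Prod>i<m. g (f i)))"
    by (simp add: sum_distrib_left)
  also have "\<dots> \<le> \<kappa> * (w ^ m * (\<Sum>f\<in>?\<Omega>. \<Phi> (hits m B f)))"
    using assms by (intro mult_left_mono sum_antimono_hits_prod_le) (auto simp: antimono_def \<Phi>_def)
  also have "\<dots> \<le> e * (\<Sum>f\<in>?\<Omega>. \<Phi> (hits m B f))"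
    using \<kappa>(2) unfolding mult.assoc[symmetric] by (intro mult_right_mono sum_nonneg) (auto simp: \<Phi>_def)
  finally show ?thesis unfolding card_eq \<Phi>_def .
qed

section \<open>Chernoff bounds on the event of few hits\<close>

text \<open>Chernoff with weight \<open>exp (- \<delta>)\<close> on each hit of \<open>C\<close>. As
  \<open>C\<close> avoids \<open>B\<close>, discarding \<open>B\<close> can only raise the
  proportion of \<open>C\<close>, so the conditioning costs nothing.\<close>

lemma card_few_hits_lower_tail:
  fixes m :: nat
  assumes "finite P" "P \<noteq> {}" "B \<subseteq> P" "C \<subseteq> P - B" "0 \<le> \<delta>"
  defines "\<mu> \<equiv> real m * real (card C) / real (card P)"
  shows "real (card {f \<in> PiE {..<m} (\<lambda>_. P). hits m B f \<le> r \<and> real (hits m C f) < (1 - \<delta>) * \<mu>})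
         \<le> exp (- (\<delta>\<^sup>2 * \<mu> / 3)) * real (card {f \<in> PiE {..<m} (\<lambda>_. P). hits m B f \<le> r})"
proof (rule card_few_hits_bad_le)
  define q where "q = real (card C) / real (card P)"
  define g where "g x = exp (- \<delta> * of_bool (x \<in> C))" for x
  have n: "real (card P) > 0" using assms(1,2) by (simp add: card_gt_0_iff)
  have sum_g: "(\<Sum>x\<in>A. g x) = real (card A) - (1 - exp (- \<delta>)) * real (card C)" if "C \<subseteq> A" "A \<subseteq> P" for A
  proof -
    have "finite A" using finite_subset[OF that(2) assms(1)] .
    have "(\<Sum>x\<in>A. g x) = (\<Sum>x\<in>A. 1 - (1 - exp (- \<delta>)) * of_bool (x \<in> C))"
      by (intro sum.cong) (auto simp: g_def)
    also have "\<dots> = real (card A) - (1 - exp (- \<delta>)) * real (card (A \<inter> C))"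
      using \<open>finite A\<close> by (simp add: sum_subtractf sum_distrib_left[symmetric])
    finally show ?thesis using that by (simp add: Int_absorb1)
  qed
  show "finite P" "B \<subseteq> P" by fact+
  show "g x \<ge> 0" for x by (simp add: g_def)
  \<comment> \<open>The average of \<open>g\<close> over \<open>P\<close>. It also bounds the
    average over any \<open>A\<close> between \<open>C\<close> and \<open>P\<close>, where
    \<open>C\<close> has a share of at least \<open>q\<close>.\<close>
  define w where "w = 1 - (1 - exp (- \<delta>)) * q"
  have d: "0 \<le> 1 - exp (- \<delta>)" "1 - exp (- \<delta>) \<le> 1" using assms(1-5) by auto
  have "card C \<le> card P" using assms(1-5) by (intro card_mono) auto
  then have q: "0 \<le> q" "q \<le> 1" using n by (auto simp: q_def)
  have "(1 - exp (- \<delta>)) * q \<le> 1 * 1" using d q by (intro mult_mono) auto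
  then show "w \<ge> 0" by (simp add: w_def)
  have wA: "(\<Sum>x\<in>A. g x) \<le> w * real (card A)" if "C \<subseteq> A" "A \<subseteq> P" for A
  proof -
    have "real (card A) \<le> real (card P)" using card_mono[OF assms(1) that(2)] by simp
    then have "q * real (card A) \<le> q * real (card P)" using q by (intro mult_left_mono) auto
    also have "\<dots> = real (card C)" using n by (simp add: q_def)
    finally have "(1 - exp (- \<delta>)) * (q * real (card A)) \<le> (1 - exp (- \<delta>)) * real (card C)"
      using d by (intro mult_left_mono) auto
    then show ?thesis unfolding sum_g[OF that] w_def by (simp add: left_diff_distrib)
  qed
  show "(\<Sum>x\<in>P. g x) \<le> w * real (card P)" "(\<Sum>x\<in>P - B. g x) \<le> w * real (card (P - B))"
    using assms(4) by (auto intro!: wA)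
  define \<kappa> where "\<kappa> = exp (\<delta> * ((1 - \<delta>) * \<mu>))"
  show "\<kappa> \<ge> 0" by (simp add: \<kappa>_def)
  show "1 \<le> \<kappa> * (\<Prod>i<m. g (f i))" if "real (hits m C f) < (1 - \<delta>) * \<mu>" for f
  proof -
    have "(\<Prod>i<m. g (f i)) = exp (- \<delta> * real (hits m C f))"
      by (simp add: g_def hits_def exp_sum[symmetric] sum_distrib_left sum_negf)
    then have "\<kappa> * (\<Prod>i<m. g (f i)) = exp (\<delta> * ((1 - \<delta>) * \<mu> - real (hits m C f)))"
      by (simp add: \<kappa>_def mult_exp_exp algebra_simps)
    then show ?thesis using that assms(5) by simp
  qed
  \<comment> \<open>The coefficient 2/3 makes the exponent
    \<open>\<delta> * (1 - \<delta>) - (1 - exp (- \<delta>))\<close> at most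
    \<open>- (\<delta>\<^sup>2 / 3)\<close>. The proof multiplies by the quadratic Taylor minorant
    of \<open>exp \<delta>\<close>.\<close>
  have exp1: "exp (- \<delta>) \<le> 1 - \<delta> + 2 * \<delta>\<^sup>2 / 3"
  proof -
    have "1 \<le> 1 + \<delta>\<^sup>2 / 6 + \<delta> ^ 3 / 6 + \<delta> ^ 4 / 3" using assms(5) by simp
    also have "\<dots> = (1 - \<delta> + 2 * \<delta>\<^sup>2 / 3) * (1 + \<delta> + \<delta>\<^sup>2 / 2)"
      by (simp add: field_simps power2_eq_square power3_eq_cube power4_eq_xxxx)
    also have "\<dots> \<le> (1 - \<delta> + 2 * \<delta>\<^sup>2 / 3) * exp \<delta>"
    proof (rule mult_left_mono[OF exp_lower_Taylor_quadratic[OF assms(5)]])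
      have "0 \<le> (1 - \<delta> / 2)\<^sup>2 + 5 * \<delta>\<^sup>2 / 12" by simp
      also have "\<dots> = 1 - \<delta> + 2 * \<delta>\<^sup>2 / 3" by (simp add: field_simps power2_eq_square)
      finally show "0 \<le> 1 - \<delta> + 2 * \<delta>\<^sup>2 / 3" .
    qed
    finally have "1 * exp (- \<delta>) \<le> (1 - \<delta> + 2 * \<delta>\<^sup>2 / 3) * exp \<delta> * exp (- \<delta>)"
      by (rule mult_right_mono) simp
    then show ?thesis by (simp add: mult.assoc exp_minus_inverse)
  qed
  define e where "e = 1 - exp (- \<delta>)"
  have e: "\<delta> * (1 - \<delta>) - e \<le> - (\<delta>\<^sup>2 / 3)"
    using exp1 unfolding e_def power2_eq_square right_diff_distrib by linarith
  have "w \<le> exp (- (e * q))"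
    using exp_ge_add_one_self[of "- (e * q)"] by (simp add: w_def e_def)
  then have "w ^ m \<le> exp (- (e * q)) ^ m"
    using \<open>w \<ge> 0\<close> by (intro power_mono) auto
  also have "\<dots> = exp (- (e * \<mu>))"
    unfolding exp_of_nat_mult[symmetric] by (simp add: \<mu>_def q_def)
  finally have "\<kappa> * w ^ m \<le> \<kappa> * exp (- (e * \<mu>))"
    by (simp add: \<kappa>_def)
  also have "\<dots> = exp (\<mu> * (\<delta> * (1 - \<delta>) - e))"
    unfolding \<kappa>_def mult_exp_exp by (simp add: algebra_simps)
  also have "\<dots> \<le> exp (\<mu> * (- (\<delta>\<^sup>2 / 3)))"
  proof -
    have "\<mu> \<ge> 0" by (simp add: \<mu>_def)
    with e show ?thesis by (intro exp_mono mult_left_mono) auto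
  qed
  finally show "\<kappa> * w ^ m \<le> exp (- (\<delta>\<^sup>2 * \<mu> / 3))" by (simp add: mult.commute)
qed

text \<open>Chernoff with weight \<open>exp (\<delta> * y x)\<close>. The factor
  \<open>1 + \<delta>\<close> absorbs the whole moment bound, so the additive slack \<open>a\<close>
  alone gives the decay, whatever the size of \<open>V\<close>.\<close>

lemma card_few_hits_upper_tail:
  fixes y :: "'b \<Rightarrow> real"
  assumes "finite P" "B \<subseteq> P" "0 \<le> \<delta>" "\<delta> \<le> 1"
    and y01: "\<And>x. x \<in> P \<Longrightarrow> 0 \<le> y x" "\<And>x. x \<in> P \<Longrightarrow> y x \<le> 1" and yB: "\<And>x. x \<in> B \<Longrightarrow> y x = 0"
    and V: "(\<Sum>x\<in>P - B. y x) \<le> V * real (card (P - B))" "V \<ge> 0"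
  shows "real (card {f \<in> PiE {..<m} (\<lambda>_. P). hits m B f \<le> r \<and> (\<Sum>i<m. y (f i)) > (1 + \<delta>) * real m * V + a})
         \<le> exp (- (\<delta> * a)) * real (card {f \<in> PiE {..<m} (\<lambda>_. P). hits m B f \<le> r})"
proof (rule card_few_hits_bad_le)
  define g where "g x = exp (\<delta> * y x)" for x
  define w where "w = exp (V * (exp \<delta> - 1))"
  define \<kappa> where "\<kappa> = exp (- \<delta> * ((1 + \<delta>) * real m * V + a))"
  show "finite P" "B \<subseteq> P" by fact+
  show "g x \<ge> 0" for x by (simp add: g_def)
  show "w \<ge> 0" "\<kappa> \<ge> 0" by (auto simp: w_def \<kappa>_def)
  have e1: "exp \<delta> - 1 \<ge> 0" using assms(3) by simp
  have w1: "w \<ge> 1" using V e1 by (simp add: w_def)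
  \<comment> \<open>On [0, 1] the convex exponential lies below its chord.\<close>
  have g_le: "g x \<le> 1 + y x * (exp \<delta> - 1)" if "x \<in> P" for x
  proof -
    have "exp ((1 - y x) *\<^sub>R 0 + y x *\<^sub>R \<delta>) \<le> (1 - y x) * exp 0 + y x * exp \<delta>"
      using exp_convex that y01[of x] by (intro convex_onD[of UNIV exp]) auto
    then show ?thesis by (simp add: g_def algebra_simps)
  qed
  have "(\<Sum>x\<in>P - B. g x) \<le> (\<Sum>x\<in>P - B. 1 + y x * (exp \<delta> - 1))"
    using g_le by (intro sum_mono) auto
  also have "\<dots> = real (card (P - B)) + (\<Sum>x\<in>P - B. y x) * (exp \<delta> - 1)"
    by (simp add: sum.distrib sum_distrib_right)
  also have "\<dots> \<le> real (card (P - B)) + V * real (card (P - B)) * (exp \<delta> - 1)"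
    using V e1 by (intro add_mono mult_right_mono) auto
  also have "\<dots> = (1 + V * (exp \<delta> - 1)) * real (card (P - B))" by (simp add: algebra_simps)
  also have "\<dots> \<le> w * real (card (P - B))"
    unfolding w_def by (intro mult_right_mono exp_ge_add_one_self) auto
  finally show gin: "(\<Sum>x\<in>P - B. g x) \<le> w * real (card (P - B))" .
  \<comment> \<open>Points of \<open>B\<close> have weight 1, which is at most \<open>w\<close>, so
    the bound passes from the inliers to all of \<open>P\<close>.\<close>
  have "(\<Sum>x\<in>P. g x) = (\<Sum>x\<in>P - B. g x) + (\<Sum>x\<in>B. g x)"
    using sum.subset_diff[OF assms(2,1), of g] by simp
  also have "(\<Sum>x\<in>B. g x) = real (card B)" by (simp add: g_def yB)
  also have "(\<Sum>x\<in>P - B. g x) + real (card B) \<le> w * real (card (P - B)) + w * real (card B)"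
    using gin w1 by (intro add_mono) (auto simp: mult_le_cancel_right1)
  also have "\<dots> = w * real (card P)"
    using assms(1,2) finite_subset[OF assms(2,1)]
    by (simp add: card_Diff_subset card_mono of_nat_diff algebra_simps)
  finally show "(\<Sum>x\<in>P. g x) \<le> w * real (card P)" .
  show "1 \<le> \<kappa> * (\<Prod>i<m. g (f i))" if "(\<Sum>i<m. y (f i)) > (1 + \<delta>) * real m * V + a" for f
  proof -
    have "(\<Prod>i<m. g (f i)) = exp (\<delta> * (\<Sum>i<m. y (f i)))"
      by (simp add: g_def exp_sum[symmetric] sum_distrib_left)
    then have "\<kappa> * (\<Prod>i<m. g (f i)) = exp (\<delta> * ((\<Sum>i<m. y (f i)) - ((1 + \<delta>) * real m * V + a)))"
      unfolding \<kappa>_def by (simp add: mult_exp_exp right_diff_distrib)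
    moreover have "0 \<le> \<delta> * ((\<Sum>i<m. y (f i)) - ((1 + \<delta>) * real m * V + a))"
      by (intro mult_nonneg_nonneg assms(3)) (simp only: diff_ge_0_iff_ge less_imp_le[OF that])
    ultimately show ?thesis by (metis one_le_exp_iff)
  qed
  have "\<kappa> * w ^ m = exp (real m * V * ((exp \<delta> - 1) - \<delta> * (1 + \<delta>)) - \<delta> * a)"
    unfolding \<kappa>_def w_def exp_of_nat_mult[symmetric] mult_exp_exp by (simp add: algebra_simps)
  also have "\<dots> \<le> exp (- (\<delta> * a))"
  proof -
    \<comment> \<open>For \<delta> in [0, 1], \<open>exp \<delta>\<close> is at most
      \<open>1 + \<delta> + \<delta>\<^sup>2\<close>.\<close>
    have "(exp \<delta> - 1) - \<delta> * (1 + \<delta>) \<le> 0"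
      using exp_bound[of \<delta>] assms(3,4) by (simp add: algebra_simps power2_eq_square)
    then have "real m * V * ((exp \<delta> - 1) - \<delta> * (1 + \<delta>)) \<le> 0"
      using V by (intro mult_nonneg_nonpos) auto
    then show ?thesis by simp
  qed
  finally show "\<kappa> * w ^ m \<le> exp (- (\<delta> * a))" .
qed

section \<open>Expected number of hits and Markov's inequality\<close>

text \<open>Linearity of expectation, with the denominator \<open>card P\<close> cleared.\<close>

lemma sum_hits:
  assumes "finite P" "B \<subseteq> P"
  shows "(\<Sum>f\<in>PiE {..<m} (\<lambda>_. P). real (hits m B f)) * real (card P)
       = real m * real (card B) * real (card P) ^ m"
proof (induction m)
  case 0
  show ?case by (simp add: hits_def)
next
  case (Suc m)
  have "(\<Sum>f\<in>PiE {..<Suc m} (\<lambda>_. P). real (hits (Suc m) B f))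
    = (\<Sum>x\<in>P. (\<Sum>f\<in>PiE {..<m} (\<lambda>_. P). real (hits m B f)) + real (card P) ^ m * of_bool (x \<in> B))"
    using assms(1) by (subst sum_PiE_lessThan_Suc) (simp_all add: sum.distrib card_PiE)
  also have "\<dots> = real (card P) * (\<Sum>f\<in>PiE {..<m} (\<lambda>_. P). real (hits m B f)) + real (card P) ^ m * real (card B)"
    using assms by (simp add: sum.distrib sum_distrib_left[symmetric] Int_absorb1)
  finally show ?case using Suc.IH by (simp add: algebra_simps)
qed

text \<open>Markov's inequality for an integer count: exceeding \<open>r\<close> means reaching
  \<open>r + 1\<close>, and this extra 1 later pays for rounding \<open>z'\<close> down.\<close>

lemma card_few_hits_ge:
  assumes "finite P" "P \<noteq> {}" "B \<subseteq> P"
    and r: "real m * real (card B) / real (card P) \<le> \<eta> * (real r + 1)"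
  shows "real (card {f \<in> PiE {..<m} (\<lambda>_. P). hits m B f \<le> r}) \<ge> (1 - \<eta>) * real (card P) ^ m"
proof -
  let ?\<Omega> = "PiE {..<m} (\<lambda>_. P)"
  let ?G = "{f \<in> ?\<Omega>. hits m B f \<le> r}"
  have fin: "finite ?\<Omega>" using assms(1) by (intro finite_PiE) auto
  have n: "real (card P) > 0" using assms(1,2) by (simp add: card_gt_0_iff)
  have "(real r + 1) * real (card (?\<Omega> - ?G)) = (\<Sum>f\<in>?\<Omega> - ?G. real r + 1)" by simp
  also have "\<dots> \<le> (\<Sum>f\<in>?\<Omega> - ?G. real (hits m B f))"
  proof (rule sum_mono)
    fix f assume "f \<in> ?\<Omega> - ?G"
    then have "\<not> hits m B f \<le> r" by blast
    then show "real r + 1 \<le> real (hits m B f)" by linarith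
  qed
  also have "\<dots> \<le> (\<Sum>f\<in>?\<Omega>. real (hits m B f))" using fin by (intro sum_mono2) auto
  also have "\<dots> = real m * real (card B) / real (card P) * real (card P) ^ m"
    using sum_hits[OF assms(1,3), of m] n by (simp add: field_simps)
  also have "\<dots> \<le> \<eta> * (real r + 1) * real (card P) ^ m" using r by (intro mult_right_mono) auto
  finally have "(real r + 1) * real (card (?\<Omega> - ?G)) \<le> (real r + 1) * (\<eta> * real (card P) ^ m)"
    by (simp add: algebra_simps)
  then have "real (card (?\<Omega> - ?G)) \<le> \<eta> * real (card P) ^ m"
    by (rule mult_left_le_imp_le) simp
  moreover have "card ?\<Omega> = card (?\<Omega> - ?G) + card ?G"
    using card_Diff_subset[of ?G ?\<Omega>] card_mono[of ?\<Omega> ?G] fin by simp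
  then have "real (card (?\<Omega> - ?G)) + real (card ?G) = real (card ?\<Omega>)" by simp
  moreover have "real (card ?\<Omega>) = real (card P) ^ m" by (simp add: card_PiE)
  ultimately show ?thesis by (simp add: algebra_simps)
qed

section \<open>Trimmed costs\<close>

lemma dist_set_le: "finite H \<Longrightarrow> q \<in> H \<Longrightarrow> dist_set p H \<le> norm (p - q)"
  unfolding dist_set_def by (intro Min_le) auto

lemma dist_set_attained:
  assumes "finite H" "H \<noteq> {}"
  obtains q where "q \<in> H" "dist_set p H = norm (p - q)"
proof -
  have "dist_set p H \<in> (\<lambda>q. norm (p - q)) ` H"
    unfolding dist_set_def using assms by (intro Min_in) auto
  then show ?thesis using that by blast
qed

lemma dist_set_nonneg: "finite H \<Longrightarrow> H \<noteq> {} \<Longrightarrow> 0 \<le> dist_set p H"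
  by (metis dist_set_attained norm_ge_zero)

lemma dist_set_antimono:
  assumes "H \<subseteq> H'" "finite H'" "H \<noteq> {}"
  shows "dist_set p H' \<le> dist_set p H"
  by (metis assms dist_set_attained dist_set_le finite_subset subsetD)

text \<open>Triangle inequality through the center nearest to \<open>q\<close>, followed by (a +
  b)^2 \<le> 2 a^2 + 2 b^2.\<close>

lemma dist_set_square_le:
  assumes "finite H" "H \<noteq> {}"
  shows "(dist_set p H)\<^sup>2 \<le> 2 * (norm (q - p))\<^sup>2 + 2 * (dist_set q H)\<^sup>2"
proof -
  obtain h where h: "h \<in> H" "dist_set q H = norm (q - h)" using dist_set_attained assms by blast
  have "dist_set p H \<le> norm (p - h)" using dist_set_le assms(1) h(1) by blast
  also have "\<dots> \<le> norm (q - p) + norm (q - h)"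
    by (metis norm_minus_commute norm_triangle_ineq diff_add_cancel add_diff_eq)
  finally have "(dist_set p H)\<^sup>2 \<le> (norm (q - p) + dist_set q H)\<^sup>2"
    using dist_set_nonneg[OF assms] h by (intro power_mono) auto
  also have "\<dots> \<le> 2 * (norm (q - p))\<^sup>2 + 2 * (dist_set q H)\<^sup>2"
    using zero_le_power2[of "norm (q - p) - dist_set q H"] by (simp add: power2_eq_square algebra_simps)
  finally show ?thesis .
qed

section \<open>Submultisets and the minimum in the trimmed cost\<close>

lemma finite_submultisets: "finite {Q'. Q' \<subseteq># Q}"
proof (induction Q)
  case empty
  then show ?case by simp
next
  case (add x Q)
  have "{Q'. Q' \<subseteq># add_mset x Q} \<subseteq> {Q'. Q' \<subseteq># Q} \<union> add_mset x ` {Q'. Q' \<subseteq># Q}"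
  proof
    fix Q' assume "Q' \<in> {Q'. Q' \<subseteq># add_mset x Q}"
    then have Q': "Q' \<subseteq># add_mset x Q" by simp
    show "Q' \<in> {Q'. Q' \<subseteq># Q} \<union> add_mset x ` {Q'. Q' \<subseteq># Q}"
    proof (cases "x \<in># Q'")
      case True
      then obtain R where "Q' = add_mset x R" by (metis multi_member_split)
      with Q' show ?thesis by auto
    next
      case False
      have "count Q' y \<le> count Q y" for y
        using mset_subset_eq_count[OF Q', of y] False by (cases "y = x") (auto simp: not_in_iff)
      then show ?thesis by (simp add: subseteq_mset_def)
    qed
  qed
  then show ?case using add by (meson finite_UnI finite_imageI finite_subset)
qed

lemma ex_submultiset_size:
  assumes "r \<le> size Q" shows "\<exists>R. R \<subseteq># Q \<and> size R = r"
proof -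
  obtain xs where xs: "mset xs = Q" using ex_mset by blast
  have "mset (take r xs) \<subseteq># mset (take r xs) + mset (drop r xs)" by simp
  also have "\<dots> = Q" using xs by (simp flip: mset_append)
  finally have "mset (take r xs) \<subseteq># Q" .
  moreover have "size (mset (take r xs)) = r" using assms xs by auto
  ultimately show ?thesis by blast
qed

lemma sum_mset_mono_subset:
  fixes h :: "'b \<Rightarrow> real"
  assumes "R \<subseteq># Q" "\<And>x. x \<in># Q \<Longrightarrow> h x \<ge> 0"
  shows "(\<Sum>x\<in>#R. h x) \<le> (\<Sum>x\<in>#Q. h x)"
proof -
  obtain T where "Q = R + T" using assms(1) by (metis subset_mset.le_iff_add)
  moreover have "0 \<le> (\<Sum>x\<in>#T. h x)"
    using sum_mset_mono[of T "\<lambda>_. 0" h] assms(2) calculation by simp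
  ultimately show ?thesis by simp
qed

text \<open>Together with the existence of a submultiset of the right size, this makes the
  \<open>Min\<close> in \<open>trimmed_cost\<close> a genuine minimum.\<close>

lemma finite_trimmed_cost_candidates:
  "finite {(1 / real (size Q')) * (\<Sum>p\<in>#Q'. (dist_set p H)\<^sup>2) | Q'. Q' \<subseteq># Q \<and> size Q' = size Q - w}"
  using finite_submultisets[of Q] by (rule finite_surj) auto

lemma trimmed_cost_le:
  assumes "Q' \<subseteq># Q" "size Q' = size Q - w"
  shows "trimmed_cost Q w H \<le> (1 / real (size Q - w)) * (\<Sum>p\<in>#Q'. (dist_set p H)\<^sup>2)"
proof -
  have "trimmed_cost Q w H \<le> (1 / real (size Q')) * (\<Sum>p\<in>#Q'. (dist_set p H)\<^sup>2)"
    unfolding trimmed_cost_def by (rule Min_le[OF finite_trimmed_cost_candidates]) (use assms in blast)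
  then show ?thesis unfolding assms(2) .
qed

lemma trimmed_cost_attained:
  obtains Q' where "Q' \<subseteq># Q" "size Q' = size Q - w"
    "trimmed_cost Q w H = (1 / real (size Q - w)) * (\<Sum>p\<in>#Q'. (dist_set p H)\<^sup>2)"
proof -
  obtain R where "R \<subseteq># Q" "size R = size Q - w" using ex_submultiset_size[of "size Q - w" Q] by auto
  then have "{(1 / real (size Q')) * (\<Sum>p\<in>#Q'. (dist_set p H)\<^sup>2) | Q'. Q' \<subseteq># Q \<and> size Q' = size Q - w} \<noteq> {}"
    by blast
  from Min_in[OF finite_trimmed_cost_candidates this] show ?thesis
    using that unfolding trimmed_cost_def by force
qed

lemma trimmed_cost_nonneg: "0 \<le> trimmed_cost Q w H"
proof -
  obtain Q' where "trimmed_cost Q w H = (1 / real (size Q - w)) * (\<Sum>p\<in>#Q'. (dist_set p H)\<^sup>2)"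
    using trimmed_cost_attained by blast
  moreover have "0 \<le> (\<Sum>p\<in>#Q'. (dist_set p H)\<^sup>2)"
    using sum_mset_mono[of Q' "\<lambda>_. 0" "\<lambda>p. (dist_set p H)\<^sup>2"] by simp
  ultimately show ?thesis by simp
qed

lemma trimmed_cost_antimono:
  assumes "H \<subseteq> H'" "finite H'" "H \<noteq> {}"
  shows "trimmed_cost Q w H' \<le> trimmed_cost Q w H"
proof -
  obtain Q' where Q': "Q' \<subseteq># Q" "size Q' = size Q - w"
    "trimmed_cost Q w H = (1 / real (size Q - w)) * (\<Sum>p\<in>#Q'. (dist_set p H)\<^sup>2)"
    using trimmed_cost_attained by blast
  have "trimmed_cost Q w H' \<le> (1 / real (size Q - w)) * (\<Sum>p\<in>#Q'. (dist_set p H')\<^sup>2)"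
    by (intro trimmed_cost_le Q')
  also have "\<dots> \<le> (1 / real (size Q - w)) * (\<Sum>p\<in>#Q'. (dist_set p H)\<^sup>2)"
    using assms by (intro mult_left_mono sum_mset_mono power_mono dist_set_antimono dist_set_nonneg) auto
  finally show ?thesis using Q' by simp
qed

lemma kmeans_out_opt_le:
  assumes "finite H" "card H = k" shows "kmeans_out_opt Q w k \<le> trimmed_cost Q w H"
  unfolding kmeans_out_opt_def
  by (rule cInf_lower) (use assms trimmed_cost_nonneg in \<open>auto simp: bdd_below_def\<close>)

text \<open>Optima range over exactly \<open>k\<close> centers, but the means of different clusters
  may coincide; such a set of means is padded to \<open>k\<close> points.\<close>

lemma ex_finite_superset_card:
  fixes H :: "'a::euclidean_space set"
  assumes "finite H" "card H \<le> k"
  shows "\<exists>H'. H \<subseteq> H' \<and> finite H' \<and> card H' = k"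
proof -
  have "infinite (UNIV :: 'a set)"
    using finite_imp_bounded not_bounded_UNIV by blast
  then have "infinite (UNIV - H)" using assms(1) by simp
  then obtain T where T: "finite T" "card T = k - card H" "T \<subseteq> UNIV - H"
    using infinite_arbitrarily_large by blast
  then have "card (H \<union> T) = k" using assms by (subst card_Un_disjoint) auto
  then show ?thesis using assms(1) T(1) by (intro exI[of _ "H \<union> T"]) auto
qed

section \<open>Cluster means\<close>

text \<open>Parallel axis identity: the cross term vanishes because the deviations from the mean sum
  to zero.\<close>

lemma sum_norm_minus_mean:
  fixes C :: "'a::euclidean_space set"
  assumes "finite C" "C \<noteq> {}"
  shows "(\<Sum>p\<in>C. (norm (p - h))\<^sup>2) = (\<Sum>p\<in>C. (norm (p - mean C))\<^sup>2) + real (card C) * (norm (mean C - h))\<^sup>2"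
proof -
  have n: "real (card C) > 0" using assms by (simp add: card_gt_0_iff)
  have "(\<Sum>p\<in>C. p - mean C) = 0"
    using n by (simp add: sum_subtractf mean_def sum_constant_scaleR)
  then have "(\<Sum>p\<in>C. (p - mean C) \<bullet> (mean C - h)) = 0"
    by (simp flip: inner_sum_left)
  moreover have "(norm (p - h))\<^sup>2 = (norm (p - mean C))\<^sup>2 + 2 * ((p - mean C) \<bullet> (mean C - h)) + (norm (mean C - h))\<^sup>2" for p
  proof -
    have "(norm (p - h))\<^sup>2 = (norm ((p - mean C) + (mean C - h)))\<^sup>2" by simp
    then show ?thesis unfolding power2_norm_eq_inner by (simp add: inner_simps inner_commute)
  qed
  then have "(\<Sum>p\<in>C. (norm (p - h))\<^sup>2) = (\<Sum>p\<in>C. (norm (p - mean C))\<^sup>2)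
      + 2 * (\<Sum>p\<in>C. (p - mean C) \<bullet> (mean C - h)) + (\<Sum>p\<in>C. (norm (mean C - h))\<^sup>2)"
    unfolding sum_distrib_left sum.distrib[symmetric] by (intro sum.cong refl)
  ultimately show ?thesis by simp
qed

lemma norm_minus_mean_le:
  fixes C :: "'a::euclidean_space set"
  assumes "finite C" "C \<noteq> {}" "\<And>q. q \<in> C \<Longrightarrow> norm (p - q) \<le> l"
  shows "norm (p - mean C) \<le> l"
proof -
  have n: "real (card C) > 0" using assms by (simp add: card_gt_0_iff)
  have "real (card C) *\<^sub>R (p - mean C) = (\<Sum>q\<in>C. p - q)"
    using n by (simp add: sum_subtractf mean_def scaleR_diff_right sum_constant_scaleR)
  then have "real (card C) * norm (p - mean C) = norm (\<Sum>q\<in>C. p - q)"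
    by (metis norm_scaleR abs_of_nat)
  also have "\<dots> \<le> (\<Sum>q\<in>C. l)" using assms by (intro sum_norm_le) auto
  finally show ?thesis using n by simp
qed

text \<open>The center nearest to the mean serves the whole cluster, and the parallel axis identity
  gives coefficient 1 where the squared triangle inequality would give 2.\<close>

lemma sum_dist_set_square_le:
  assumes "finite H" "H \<noteq> {}" "finite C" "C \<noteq> {}"
  shows "(\<Sum>p\<in>C. (dist_set p H)\<^sup>2) \<le> (\<Sum>p\<in>C. (norm (p - mean C))\<^sup>2) + real (card C) * (dist_set (mean C) H)\<^sup>2"
proof -
  obtain h where h: "h \<in> H" "dist_set (mean C) H = norm (mean C - h)" using dist_set_attained assms by blast
  have "(\<Sum>p\<in>C. (dist_set p H)\<^sup>2) \<le> (\<Sum>p\<in>C. (norm (p - h))\<^sup>2)"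
    using assms h by (intro sum_mono power_mono dist_set_le dist_set_nonneg) auto
  then show ?thesis using sum_norm_minus_mean[OF assms(3,4), of h] h(2) by simp
qed


section \<open>Clustering bound from a representative sample\<close>

text \<open>For disjoint clusters at most one summand is nonzero: the value is the squared distance
  to the mean of the own cluster, and 0 at outliers. The indicator form allows sums over clusters
  and samples to be exchanged.\<close>

definition cluster_sqdist :: "nat \<Rightarrow> (nat \<Rightarrow> 'a::euclidean_space set) \<Rightarrow> 'a \<Rightarrow> real" where
  "cluster_sqdist k C p = (\<Sum>j<k. of_bool (p \<in> C j) * (norm (p - mean (C j)))\<^sup>2)"

lemma cluster_sqdist_nonneg: "0 \<le> cluster_sqdist k C p"
  unfolding cluster_sqdist_def by (intro sum_nonneg) auto

lemma cluster_sqdist_eq: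
  assumes "j < k" "p \<in> C j" "\<And>i. i < k \<Longrightarrow> i \<noteq> j \<Longrightarrow> C i \<inter> C j = {}"
  shows "cluster_sqdist k C p = (norm (p - mean (C j)))\<^sup>2"
proof -
  have "cluster_sqdist k C p = (\<Sum>i<k. if i = j then (norm (p - mean (C j)))\<^sup>2 else 0)"
    unfolding cluster_sqdist_def using assms by (intro sum.cong) auto
  then show ?thesis using assms(1) by simp
qed

lemma sum_mset_filter:
  fixes h :: "'b \<Rightarrow> real"
  shows "(\<Sum>x\<in>#filter_mset Q M. h x) = (\<Sum>x\<in>#M. of_bool (Q x) * h x)"
  by (induction M) auto

lemma sum_sum_mset_swap:
  fixes h :: "'c \<Rightarrow> 'b \<Rightarrow> real"
  shows "(\<Sum>j\<in>J. \<Sum>x\<in>#M. h j x) = (\<Sum>x\<in>#M. \<Sum>j\<in>J. h j x)"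
  by (induction M) (auto simp: sum.distrib)

text \<open>At most \<open>w\<close> points are dropped in passing to \<open>S'\<close>; truncated
  subtraction covers \<open>w > size S\<close>.\<close>

lemma size_filter_submset_ge:
  assumes "S' \<subseteq># S" "size S' = size S - w"
  shows "size (filter_mset Q S) \<le> size (filter_mset Q S') + w"
proof -
  obtain T where T: "S = S' + T" using assms(1) by (metis subset_mset.le_iff_add)
  then have "size S = size S' + size T" by simp
  then have "size T \<le> w" using assms(2) by linarith
  then have "size (filter_mset Q T) \<le> w" using size_filter_mset_lesseq[of Q T] by linarith
  then show ?thesis using T by simp
qed

text \<open>The deterministic core. \<open>H\<close> discards at most \<open>w\<close> samples, so
  each cluster keeps at least \<open>\<gamma> * card (C j)\<close> of them, and every kept sample
  pays a share of the squared distance from its mean to \<open>H\<close>. The cost of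
  \<open>H\<close> in this payment is at most \<open>c\<close> times that of the means, which may
  ignore all sampled outliers.\<close>

lemma sample_clustering_bound:
  fixes C :: "nat \<Rightarrow> 'a::euclidean_space set" and S :: "'a multiset"
  assumes k: "k \<ge> 1" and c: "c \<ge> 0" and \<gamma>: "\<gamma> > 0"
    and C: "\<And>j. j < k \<Longrightarrow> finite (C j)" "\<And>j. j < k \<Longrightarrow> C j \<noteq> {}"
    and C_disj: "\<And>i j. i < k \<Longrightarrow> j < k \<Longrightarrow> i \<noteq> j \<Longrightarrow> C i \<inter> C j = {}"
    and H: "is_c_approx c S w k H"
    and out: "size {#s \<in># S. s \<notin> (\<Union>j<k. C j)#} \<le> w"
    and many: "\<And>j. j < k \<Longrightarrow> real w + \<gamma> * real (card (C j)) \<le> real (size {#s \<in># S. s \<in> C j#})"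
  shows "(\<Sum>j<k. \<Sum>p\<in>C j. (dist_set p H)\<^sup>2)
      \<le> (\<Sum>j<k. \<Sum>p\<in>C j. (norm (p - mean (C j)))\<^sup>2) + (2 + 2 * c) / \<gamma> * (\<Sum>s\<in>#S. cluster_sqdist k C s)"
proof -
  let ?y = "cluster_sqdist k C"
  let ?d = "\<lambda>j. (dist_set (mean (C j)) H)\<^sup>2"
  have H': "finite H" "card H = k" "trimmed_cost S w H \<le> c * kmeans_out_opt S w k"
    using H by (auto simp: is_c_approx_def)
  then have Hne: "H \<noteq> {}" using k by auto
  define r where "r = size S - w"
  obtain S' where S': "S' \<subseteq># S" "size S' = size S - w"
    "trimmed_cost S w H = (1 / real (size S - w)) * (\<Sum>p\<in>#S'. (dist_set p H)\<^sup>2)"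
    using trimmed_cost_attained by blast
  define D where "D = (\<Sum>p\<in>#S'. (dist_set p H)\<^sup>2)"
  \<comment> \<open>For \<open>r = 0\<close> the factor \<open>1 / real r\<close> is 0 by
    convention, but then \<open>S'\<close> is empty and both sides vanish.\<close>
  have D: "D = real r * trimmed_cost S w H"
  proof (cases "r = 0")
    case True
    then show ?thesis using S'(2) by (simp add: D_def r_def)
  next
    case False
    then show ?thesis using S'(3) by (simp add: D_def r_def)
  qed
  define Sin where "Sin = {#s \<in># S. s \<in> (\<Union>j<k. C j)#}"
  have "size S = size Sin + size {#s \<in># S. s \<notin> (\<Union>j<k. C j)#}"
    unfolding Sin_def by (metis multiset_partition size_union)
  \<comment> \<open>At most \<open>w\<close> samples are outliers, so \<open>r\<close> samples
    inside the clusters exist; they form a candidate submultiset for the cost of the means.\<close>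
  then have "r \<le> size Sin" using out by (simp add: r_def)
  then obtain R where R: "R \<subseteq># Sin" "size R = r" using ex_submultiset_size by blast
  have Sin: "Sin \<subseteq># S" by (simp add: Sin_def)
  have "card ((\<lambda>j. mean (C j)) ` {..<k}) \<le> k" using card_image_le[of "{..<k}" "\<lambda>j. mean (C j)"] by simp
  then obtain M where M: "(\<lambda>j. mean (C j)) ` {..<k} \<subseteq> M" "finite M" "card M = k"
    using ex_finite_superset_card by (metis finite_imageI finite_lessThan)
  have Mne: "M \<noteq> {}" using M(3) k by auto
  have "D \<le> real r * (c * trimmed_cost S w M)"
    unfolding D using H'(3) kmeans_out_opt_le[OF M(2,3), of S w] c
    by (meson mult_left_mono of_nat_0_le_iff order_trans)
  also have "\<dots> = c * (real r * trimmed_cost S w M)" by simp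
  also have "\<dots> \<le> c * (\<Sum>s\<in>#S. ?y s)"
  proof (intro mult_left_mono c)
    have "real r * trimmed_cost S w M \<le> (\<Sum>s\<in>#R. (dist_set s M)\<^sup>2)"
    proof (cases "r = 0")
      case True
      then show ?thesis using R by simp
    next
      case False
      have "trimmed_cost S w M \<le> (1 / real r) * (\<Sum>s\<in>#R. (dist_set s M)\<^sup>2)"
        unfolding r_def using R Sin by (intro trimmed_cost_le) (auto simp: r_def)
      then show ?thesis using False by (simp add: field_simps)
    qed
    also have "\<dots> \<le> (\<Sum>s\<in>#R. ?y s)"
    proof (rule sum_mset_mono)
      fix s assume "s \<in># R"
      then have "s \<in># Sin" using R(1) by (meson mset_subset_eqD)
      then obtain j where j: "j < k" "s \<in> C j" by (auto simp: Sin_def)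
      have "dist_set s M \<le> norm (s - mean (C j))" using M j by (intro dist_set_le) auto
      then have "(dist_set s M)\<^sup>2 \<le> (norm (s - mean (C j)))\<^sup>2"
        using dist_set_nonneg[OF M(2) Mne] by (intro power_mono) auto
      then show "(dist_set s M)\<^sup>2 \<le> ?y s" using cluster_sqdist_eq[of j k s C] j C_disj by simp
    qed
    also have "\<dots> \<le> (\<Sum>s\<in>#S. ?y s)"
      using R(1) Sin cluster_sqdist_nonneg by (intro sum_mset_mono_subset) auto
    finally show "real r * trimmed_cost S w M \<le> (\<Sum>s\<in>#S. ?y s)" .
  qed
  finally have D_le: "D \<le> c * (\<Sum>s\<in>#S. ?y s)" .

  \<comment> \<open>Each kept sample of \<open>C j\<close> bounds \<open>?d j\<close>; adding up
    these bounds gives at least the weight on the left.\<close>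
  have "\<gamma> * (\<Sum>j<k. real (card (C j)) * ?d j)
      \<le> (\<Sum>j<k. \<Sum>s\<in>#{#s \<in># S'. s \<in> C j#}. 2 * (norm (s - mean (C j)))\<^sup>2 + 2 * (dist_set s H)\<^sup>2)"
    unfolding sum_distrib_left
  proof (rule sum_mono)
    fix j assume "j \<in> {..<k}"
    then have j: "j < k" by simp
    have "real (size {#s \<in># S. s \<in> C j#}) \<le> real (size {#s \<in># S'. s \<in> C j#}) + real w"
      using size_filter_submset_ge[OF S'(1,2), of "\<lambda>s. s \<in> C j"] by linarith
    then have "\<gamma> * real (card (C j)) \<le> real (size {#s \<in># S'. s \<in> C j#})" using many[OF j] by linarith
    then have "\<gamma> * real (card (C j)) * ?d j \<le> real (size {#s \<in># S'. s \<in> C j#}) * ?d j"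
      by (intro mult_right_mono) auto
    also have "\<dots> = (\<Sum>s\<in>#{#s \<in># S'. s \<in> C j#}. ?d j)" by simp
    also have "\<dots> \<le> (\<Sum>s\<in>#{#s \<in># S'. s \<in> C j#}. 2 * (norm (s - mean (C j)))\<^sup>2 + 2 * (dist_set s H)\<^sup>2)"
      by (intro sum_mset_mono dist_set_square_le H' Hne)
    finally show "\<gamma> * (real (card (C j)) * ?d j) \<le> \<dots>" by (simp add: mult.assoc)
  qed
  also have "\<dots> = (\<Sum>s\<in>#S'. \<Sum>j<k. of_bool (s \<in> C j) * (2 * (norm (s - mean (C j)))\<^sup>2 + 2 * (dist_set s H)\<^sup>2))"
    unfolding sum_mset_filter sum_sum_mset_swap ..
  also have "\<dots> \<le> (\<Sum>s\<in>#S'. 2 * ?y s + 2 * (dist_set s H)\<^sup>2)"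
  proof (rule sum_mset_mono)
    fix s assume "s \<in># S'"
    \<comment> \<open>A sample lies in at most one cluster, so its distance to \<open>H\<close> is
      charged at most once.\<close>
    have one: "(\<Sum>j<k. of_bool (s \<in> C j)) \<le> (1::real)"
    proof (cases "\<exists>j<k. s \<in> C j")
      case True
      then obtain j where j: "j < k" "s \<in> C j" by blast
      then have "(\<Sum>i<k. of_bool (s \<in> C i)) = (\<Sum>i<k. if i = j then 1 else (0::real))"
        using C_disj by (intro sum.cong) auto
      then show ?thesis using j by simp
    next
      case False
      then have "(\<Sum>j<k. of_bool (s \<in> C j)) = (\<Sum>j<k. (0::real))" by (intro sum.cong) auto
      then show ?thesis by simp
    qed
    have "(\<Sum>j<k. of_bool (s \<in> C j) * (2 * (norm (s - mean (C j)))\<^sup>2 + 2 * (dist_set s H)\<^sup>2))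
      = 2 * ?y s + (\<Sum>j<k. of_bool (s \<in> C j)) * (2 * (dist_set s H)\<^sup>2)"
      unfolding cluster_sqdist_def sum_distrib_left sum_distrib_right sum.distrib[symmetric]
      by (intro sum.cong) (auto simp: algebra_simps)
    also have "\<dots> \<le> 2 * ?y s + 1 * (2 * (dist_set s H)\<^sup>2)"
      using one by (intro add_left_mono mult_right_mono) auto
    finally show "(\<Sum>j<k. of_bool (s \<in> C j) * (2 * (norm (s - mean (C j)))\<^sup>2 + 2 * (dist_set s H)\<^sup>2))
      \<le> 2 * ?y s + 2 * (dist_set s H)\<^sup>2" by simp
  qed
  also have "\<dots> = 2 * (\<Sum>s\<in>#S'. ?y s) + 2 * D"
    unfolding D_def by (simp add: sum_mset.distrib sum_mset_distrib_left)
  also have "\<dots> \<le> 2 * (\<Sum>s\<in>#S. ?y s) + 2 * (c * (\<Sum>s\<in>#S. ?y s))"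
    using D_le sum_mset_mono_subset[OF S'(1), of ?y] cluster_sqdist_nonneg by (intro add_mono) auto
  finally have "(\<Sum>j<k. real (card (C j)) * ?d j) \<le> (2 + 2 * c) / \<gamma> * (\<Sum>s\<in>#S. ?y s)"
    using \<gamma> by (simp add: field_simps)
  moreover have "(\<Sum>j<k. \<Sum>p\<in>C j. (dist_set p H)\<^sup>2)
    \<le> (\<Sum>j<k. (\<Sum>p\<in>C j. (norm (p - mean (C j)))\<^sup>2) + real (card (C j)) * ?d j)"
    using C H' Hne by (intro sum_mono sum_dist_set_square_le) auto
  ultimately show ?thesis by (simp add: sum.distrib)
qed

section \<open>The sampling theorem\<close>

lemma sum_mset_sample:
  fixes h :: "'b \<Rightarrow> real"
  shows "(\<Sum>s\<in>#image_mset f (mset_set {..<m}). h s) = (\<Sum>i<m. h (f i))"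
  by (simp add: image_mset.compositionality comp_def sum_unfold_sum_mset)

lemma size_filter_sample: "size {#s \<in># image_mset f (mset_set {..<m}). s \<in> X#} = hits m X f"
proof -
  have "real (size {#s \<in># M. s \<in> X#}) = (\<Sum>s\<in>#M. of_bool (s \<in> X))" for M
    by (induction M) auto
  then have "real (size {#s \<in># image_mset f (mset_set {..<m}). s \<in> X#}) = real (hits m X f)"
    by (simp only: sum_mset_sample hits_def of_nat_sum of_nat_of_bool)
  then show ?thesis by (simp only: of_nat_eq_iff)
qed

theorem theorem4:
  fixes P :: "'a::euclidean_space set"
    and k z :: nat and C :: "nat \<Rightarrow> 'a set"
    and \<epsilon>1 \<epsilon>2 \<eta> \<delta> \<xi> c :: real
    and A :: "'a multiset \<Rightarrow> 'a set"
  defines "n \<equiv> card P"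
  defines "P_opt \<equiv> (\<Union>j<k. C j)"
  defines "O_star \<equiv> mean ` C ` {..<k}"
  defines "L \<equiv> Max ((\<lambda>j. Max {norm (p - q) | p q. p \<in> C j \<and> q \<in> C j}) ` {..<k})"
  defines "t \<equiv> \<eta> * (1 - \<delta>) * \<epsilon>1 / \<epsilon>2"
  defines "m \<equiv> nat \<lceil>max (3 * real k / (\<delta>\<^sup>2 * \<epsilon>1) * ln (2 * real k / \<eta>))
                         (real k / (2 * \<xi>\<^sup>2 * \<epsilon>1 * (1 - \<delta>)) * ln (2 * real k / \<eta>))\<rceil>"
  defines "z' \<equiv> nat \<lfloor>(1 / \<eta>) * (\<epsilon>2 / real k) * real m\<rfloor>"
  defines "\<alpha> \<equiv> 2 + (4 + 4 * c) * (t / (t - 1)) * ((1 + \<delta>) / (1 - \<delta>))"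
  defines "\<beta> \<equiv> (4 + 4 * c) * (t / (t - 1)) * ((1 + \<delta>) / (1 - \<delta>))"
  assumes P_fin: "finite P" and P_ne: "P \<noteq> {}"
    and k_pos: "k \<ge> 1"
    and z_less: "z < n"
    \<comment> \<open>C 0, ..., C (k-1) are the optimal clusters of an optimal solution with z outliers\<close>
    and C_ne: "\<And>j. j < k \<Longrightarrow> C j \<noteq> {}"
    and C_disj: "\<And>i j. i < k \<Longrightarrow> j < k \<Longrightarrow> i \<noteq> j \<Longrightarrow> C i \<inter> C j = {}"
    and P_opt_sub: "P_opt \<subseteq> P"
    and P_opt_card: "card P_opt = n - z"
    and C_opt: "\<And>H. finite H \<Longrightarrow> card H = k \<Longrightarrow>
        (1 / real (n - z)) * (\<Sum>j<k. \<Sum>p\<in>C j. (norm (p - mean (C j)))\<^sup>2)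
          \<le> trimmed_cost (mset_set P) z H"
    \<comment> \<open>(epsilon1, epsilon2)-significance\<close>
    and eps1: "\<epsilon>1 > 0" and eps2: "\<epsilon>2 > 0"
    and sig1: "\<And>j. j < k \<Longrightarrow> real (card (C j)) \<ge> \<epsilon>1 / real k * real n"
    and sig2: "real z = \<epsilon>2 / real k * real n"
    and eta: "0 < \<eta>" "\<eta> < 1" and delta: "0 < \<delta>" "\<delta> < 1" and xi: "0 < \<xi>" "\<xi> < 1"
    and t_gt: "t > 1"
    and c_ge: "c \<ge> 1"
    \<comment> \<open>A is an arbitrary c-approximation algorithm for k-means with z' outliers\<close>
    and A_approx: "\<And>S. set_mset S \<subseteq> P \<Longrightarrow> size S = m \<Longrightarrow> is_c_approx c S z' k (A S)"
  shows "measure_pmf.prob (pmf_of_set (PiE {..<m} (\<lambda>_. P)))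
           {f. trimmed_cost (mset_set P) z (A (image_mset f (mset_set {..<m})))
                 \<le> \<alpha> * trimmed_cost (mset_set P) z O_star + \<beta> * \<xi> * L\<^sup>2}
         \<ge> (1 - \<eta>) ^ 3"
proof -

  \<comment> \<open>Consequences of the parameters and of significance\<close>
  define l where "l = ln (2 * real k / \<eta>)"
  have "2 * real k / \<eta> > 1" using k_pos eta by (simp add: field_simps)
  \<comment> \<open>\<open>exp (- l)\<close> is the failure share allotted to one cluster;
    \<open>k\<close> of them add up to \<open>\<eta> / 2\<close>.\<close>
  then have l: "l > 0" and exp_l: "exp (- l) = \<eta> / (2 * real k)"
    by (auto simp: l_def exp_minus)
  have k: "real k \<ge> 1" using k_pos by simp
  have n: "real n > 0" using z_less by simp
  have m_ge: "real m \<ge> 3 * real k / (\<delta>\<^sup>2 * \<epsilon>1) * l" "real m \<ge> real k / (2 * \<xi>\<^sup>2 * \<epsilon>1 * (1 - \<delta>)) * l"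
    unfolding m_def l_def by (rule order_trans[OF _ real_nat_ceiling_ge], simp)+
  have "3 * real k / (\<delta>\<^sup>2 * \<epsilon>1) * l > 0" using k delta eps1 l by simp
  then have m_pos: "real m > 0" using m_ge(1) by linarith

  have C_sub: "C j \<subseteq> P" if "j < k" for j using P_opt_sub that by (auto simp: P_opt_def)
  then have C_fin: "finite (C j)" if "j < k" for j using that P_fin finite_subset by blast
  have nz: "real (n - z) = real n - real z" "real (n - z) > 0" using z_less by auto
  have card_sum: "(\<Sum>j<k. real (card (C j))) = real (n - z)"
  proof -
    have "card P_opt = (\<Sum>j<k. card (C j))"
      unfolding P_opt_def using C_fin C_disj by (intro card_UN_disjoint) auto
    then show ?thesis using P_opt_card by simp
  qed
  have nz_ge: "\<epsilon>1 * real n \<le> real (n - z)"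
  proof -
    have "\<epsilon>1 * real n = (\<Sum>j<k. \<epsilon>1 / real k * real n)" using k by simp
    also have "\<dots> \<le> (\<Sum>j<k. real (card (C j)))" using sig1 by (intro sum_mono) auto
    finally show ?thesis using card_sum by simp
  qed
  have eps2_eq: "\<epsilon>2 / \<eta> = (1 - \<delta>) * \<epsilon>1 / t"
    unfolding t_def using eps1 eps2 eta delta by simp
  \<comment> \<open>\<open>t > 1\<close> forces \<open>\<epsilon>2 < \<epsilon>1\<close>, so the
    outliers are no more numerous than the cluster \<open>C 0\<close> alone, and the inliers make up
    at least half of \<open>P\<close>.\<close>
  have n_le: "real n \<le> 2 * real (n - z)"
  proof -
    have "\<epsilon>2 < \<eta> * (1 - \<delta>) * \<epsilon>1" using t_gt eps2 unfolding t_def by (simp add: less_divide_eq)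
    also have "\<dots> \<le> 1 * \<epsilon>1" using eta delta eps1 by (intro mult_right_mono mult_le_one) auto
    finally have "\<epsilon>2 / real k * real n \<le> \<epsilon>1 / real k * real n"
      using k n by (intro mult_right_mono divide_right_mono) auto
    also have "\<dots> \<le> real (card (C 0))" using sig1 k_pos by auto
    also have "\<dots> \<le> (\<Sum>j<k. real (card (C j)))" using k_pos by (intro member_le_sum) auto
    finally show ?thesis using card_sum sig2 nz by simp
  qed

  \<comment> \<open>Squared distances to the own mean\<close>
  have L_ge: "norm (p - q) \<le> L" if "j < k" "p \<in> C j" "q \<in> C j" for j p q
  proof -
    have "{norm (p - q) | p q. p \<in> C j \<and> q \<in> C j} = (\<lambda>(p, q). norm (p - q)) ` (C j \<times> C j)" by auto
    then have "finite {norm (p - q) | p q. p \<in> C j \<and> q \<in> C j}" using C_fin[OF that(1)] by simp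
    then have "norm (p - q) \<le> Max {norm (p - q) | p q. p \<in> C j \<and> q \<in> C j}"
      using that by (intro Max_ge) auto
    also have "\<dots> \<le> L" unfolding L_def using that(1) by (intro Max_ge) auto
    finally show ?thesis .
  qed
  define y where "y = cluster_sqdist k C"
  have y_nonneg: "0 \<le> y x" for x by (simp add: y_def cluster_sqdist_nonneg)
  have y_eq: "y x = (norm (x - mean (C j)))\<^sup>2" if "j < k" "x \<in> C j" for x j
    unfolding y_def using that C_disj by (intro cluster_sqdist_eq) auto
  have y_out: "y x = 0" if "x \<notin> P_opt" for x
    unfolding y_def cluster_sqdist_def using that by (intro sum.neutral) (auto simp: P_opt_def)
  have y_le: "y x \<le> L\<^sup>2" for x
  proof (cases "x \<in> P_opt")
    case True
    then obtain j where j: "j < k" "x \<in> C j" by (auto simp: P_opt_def)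
    have "norm (x - mean (C j)) \<le> L"
      using j L_ge by (intro norm_minus_mean_le C_fin C_ne) auto
    then show ?thesis unfolding y_eq[OF j] by (intro power_mono) auto
  qed (simp add: y_out)
  define V where "V = (\<Sum>j<k. \<Sum>p\<in>C j. (norm (p - mean (C j)))\<^sup>2)"
  have V_eq: "V = (\<Sum>p\<in>P_opt. y p)"
    unfolding V_def P_opt_def using C_fin C_disj
    by (subst sum.UNION_disjoint) (auto intro!: sum.cong simp: y_eq)
  have V_nonneg: "V \<ge> 0" unfolding V_eq using y_nonneg by (intro sum_nonneg) auto

  \<comment> \<open>Outliers and sample events\<close>
  define B where "B = P - P_opt"
  have B: "B \<subseteq> P" "P - B = P_opt" using P_opt_sub by (auto simp: B_def)
  have card_B: "card B = z"
    unfolding B_def using P_opt_sub P_fin P_opt_card z_less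
    by (subst card_Diff_subset) (auto intro: finite_subset simp: n_def)
  let ?\<Omega> = "PiE {..<m} (\<lambda>_. P)"
  define \<mu> where "\<mu> j = real m * real (card (C j)) / real n" for j
  \<comment> \<open>Scaled by \<open>L\<^sup>2\<close>, this slack becomes
    \<open>\<xi> * L\<^sup>2 * real (n - z)\<close> with the same prefactor that \<open>V\<close>
    receives below.\<close>
  define a where "a = 2 * (1 + \<delta>) * (real m / real n) * real (n - z) * \<xi>"
  \<comment> \<open>The average of \<open>y x / L\<^sup>2\<close> over the inliers. If
    \<open>L = 0\<close>, then \<open>y\<close> vanishes and division by zero gives 0 as
    well.\<close>
  define V' where "V' = V / L\<^sup>2 / real (n - z)"
  define F where "F = {f \<in> ?\<Omega>. hits m B f \<le> z'}"
  define bad where "bad j = {f \<in> ?\<Omega>. hits m B f \<le> z' \<and> real (hits m (C j) f) < (1 - \<delta>) * \<mu> j}" for j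
  define badY where "badY = {f \<in> ?\<Omega>. hits m B f \<le> z' \<and> (\<Sum>i<m. y (f i) / L\<^sup>2) > (1 + \<delta>) * real m * V' + a}"
  define good where "good = {f. trimmed_cost (mset_set P) z (A (image_mset f (mset_set {..<m})))
                 \<le> \<alpha> * trimmed_cost (mset_set P) z O_star + \<beta> * \<xi> * L\<^sup>2}"
  have fin: "finite ?\<Omega>" using P_fin by (intro finite_PiE) auto

  \<comment> \<open>The tolerated outliers are at most a \<open>1 / t\<close> share of the samples
    guaranteed to each cluster, as \<open>t\<close> is the ratio of
    \<open>(1 - \<delta>) * \<epsilon>1\<close> to \<open>\<epsilon>2 / \<eta>\<close>.\<close>
  have z'_le: "real z' \<le> (1 - \<delta>) * \<mu> j / t" if "j < k" for j
  proof -
    have "real z' \<le> (1 / \<eta>) * (\<epsilon>2 / real k) * real m"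
      unfolding z'_def using eta eps2 by simp
    also have "\<dots> = (\<epsilon>2 / \<eta>) / real k * real m" by simp
    also have "\<dots> = ((1 - \<delta>) * real m / t) * (\<epsilon>1 / real k)" unfolding eps2_eq by simp
    also have "\<dots> \<le> ((1 - \<delta>) * real m / t) * (real (card (C j)) / real n)"
      using sig1[OF that] delta t_gt n by (intro mult_left_mono) (auto simp: le_divide_eq)
    finally show ?thesis by (simp add: \<mu>_def mult_ac)
  qed

  \<comment> \<open>Quality of the centers on a good sample\<close>
  have good: "f \<in> good" if f: "f \<in> ?\<Omega>" and few: "hits m B f \<le> z'"
    and many: "\<And>j. j < k \<Longrightarrow> real (hits m (C j) f) \<ge> (1 - \<delta>) * \<mu> j"
    and Y: "(\<Sum>i<m. y (f i) / L\<^sup>2) \<le> (1 + \<delta>) * real m * V' + a" for f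
  proof -
    define S where "S = image_mset f (mset_set {..<m})"
    have fP: "f i \<in> P" if "i < m" for i using f that by auto
    have S_P: "set_mset S \<subseteq> P" using fP by (auto simp: S_def)
    have S_size: "size S = m" by (simp add: S_def)
    define H where "H = A S"
    have H: "is_c_approx c S z' k H" unfolding H_def by (rule A_approx[OF S_P S_size])
    \<comment> \<open>Per cluster point: the guaranteed \<open>(1 - \<delta>) * (m / n)\<close>
      samples, less the \<open>1 / t\<close> share that outlier removal may take away.\<close>
    define \<gamma> where "\<gamma> = (1 - \<delta>) * (real m / real n) * (1 - 1 / t)"
    have \<gamma>: "\<gamma> > 0" using delta m_pos n t_gt by (simp add: \<gamma>_def)
    have "{#s \<in># S. s \<notin> P_opt#} = {#s \<in># S. s \<in> B#}"
      using S_P by (intro filter_mset_cong) (auto simp: B_def)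
    then have out: "size {#s \<in># S. s \<notin> P_opt#} \<le> z'"
      using few by (simp add: S_def size_filter_sample)
    have cnt: "real z' + \<gamma> * real (card (C j)) \<le> real (size {#s \<in># S. s \<in> C j#})" if "j < k" for j
    proof -
      have "\<gamma> * real (card (C j)) = (1 - \<delta>) * \<mu> j * (1 - 1 / t)"
        by (simp add: \<gamma>_def \<mu>_def)
      also have "\<dots> = (1 - \<delta>) * \<mu> j - (1 - \<delta>) * \<mu> j / t" by (simp add: right_diff_distrib)
      finally have "\<gamma> * real (card (C j)) = (1 - \<delta>) * \<mu> j - (1 - \<delta>) * \<mu> j / t" .
      then show ?thesis using z'_le[OF that] many[OF that] by (simp add: S_def size_filter_sample)
    qed
    have "(\<Sum>s\<in>#S. y s) = L\<^sup>2 * (\<Sum>i<m. y (f i) / L\<^sup>2)"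
      unfolding S_def sum_mset_sample sum_distrib_left
      using y_le y_nonneg by (intro sum.cong) (auto intro: antisym)
    also have "\<dots> \<le> L\<^sup>2 * ((1 + \<delta>) * real m * V' + a)" using Y by (intro mult_left_mono) auto
    also have "\<dots> = (1 + \<delta>) * real m * (L\<^sup>2 * V') + L\<^sup>2 * a" by (simp add: algebra_simps)
    also have "L\<^sup>2 * V' = V / real (n - z)"
      using y_le y_nonneg by (cases "L = 0") (auto simp: V'_def V_eq intro!: sum_nonpos sum_nonneg antisym)
    \<comment> \<open>Passing from denominator \<open>n - z\<close> to \<open>n\<close> costs the
      factor 2, by \<open>n_le\<close>.\<close>
    also have "(1 + \<delta>) * real m * (V / real (n - z)) \<le> (1 + \<delta>) * real m * (2 * V / real n)"
      using n_le V_nonneg n nz delta mult_left_mono[OF n_le V_nonneg]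
      by (intro mult_left_mono) (auto simp: field_simps)
    finally have Y_le: "(\<Sum>s\<in>#S. y s) \<le> 2 * (1 + \<delta>) * (real m / real n) * (V + \<xi> * L\<^sup>2 * real (n - z))"
      by (simp add: a_def algebra_simps add_divide_distrib)
    have "(\<Sum>j<k. \<Sum>p\<in>C j. (dist_set p H)\<^sup>2) \<le> V + (2 + 2 * c) / \<gamma> * (\<Sum>s\<in>#S. y s)"
      unfolding V_def y_def
      using k_pos c_ge \<gamma> C_fin C_ne C_disj H out cnt unfolding P_opt_def by (intro sample_clustering_bound) auto
    also have "\<dots> \<le> V + (2 + 2 * c) / \<gamma> * (2 * (1 + \<delta>) * (real m / real n) * (V + \<xi> * L\<^sup>2 * real (n - z)))"
      using Y_le \<gamma> c_ge by (intro add_left_mono mult_left_mono) auto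
    \<comment> \<open>The 2 from squaring distances and the 2 from \<open>n_le\<close> combine to
      \<open>4 + 4 * c\<close>, and \<open>m / n\<close> cancels.\<close>
    also have "\<dots> = V + \<beta> * (V + \<xi> * L\<^sup>2 * real (n - z))"
    proof -
      have t_eq: "1 - 1 / t = (t - 1) / t" using t_gt by (simp add: field_simps)
      have aux: "(2 + 2 * c) / (d * q * (e / t)) * (2 * D * q) = (4 + 4 * c) * (t / e) * (D / d)"
        if "d \<noteq> 0" "q \<noteq> 0" "e \<noteq> 0" for d q e D :: real
        using that t_gt by (simp add: field_simps)
      have "(2 + 2 * c) / \<gamma> * (2 * (1 + \<delta>) * (real m / real n)) = \<beta>"
        unfolding \<gamma>_def \<beta>_def t_eq by (rule aux) (use m_pos n delta t_gt in auto)
      then show ?thesis by (simp only: mult.assoc[symmetric])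
    qed
    finally have sum_le: "(\<Sum>j<k. \<Sum>p\<in>C j. (dist_set p H)\<^sup>2) \<le> V + \<beta> * (V + \<xi> * L\<^sup>2 * real (n - z))" .
    have "trimmed_cost (mset_set P) z H
       \<le> (1 / real (size (mset_set P) - z)) * (\<Sum>p\<in>#mset_set P_opt. (dist_set p H)\<^sup>2)"
      using P_opt_sub P_fin P_opt_card
      by (intro trimmed_cost_le) (auto simp: n_def intro: subset_imp_msubset_mset_set)
    also have "\<dots> = (1 / real (n - z)) * (\<Sum>j<k. \<Sum>p\<in>C j. (dist_set p H)\<^sup>2)"
    proof -
      have "(\<Sum>p\<in>P_opt. (dist_set p H)\<^sup>2) = (\<Sum>j<k. \<Sum>p\<in>C j. (dist_set p H)\<^sup>2)"
        unfolding P_opt_def using C_fin C_disj by (intro sum.UNION_disjoint) auto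
      then show ?thesis by (simp add: n_def sum_unfold_sum_mset)
    qed
    also have "\<dots> \<le> (1 / real (n - z)) * (V + \<beta> * (V + \<xi> * L\<^sup>2 * real (n - z)))"
      using sum_le by (intro mult_left_mono) auto
    also have "\<dots> = (1 + \<beta>) * ((1 / real (n - z)) * V) + \<beta> * \<xi> * L\<^sup>2"
      using nz(2) by (simp add: field_simps del: of_nat_diff)
    \<comment> \<open>The derived coefficient \<open>1 + \<beta>\<close> lies below
      \<open>\<alpha> = 2 + \<beta>\<close>. The means are padded to \<open>k\<close> centers, as
      \<open>C_opt\<close> speaks of exactly \<open>k\<close>.\<close>
    also have "\<dots> \<le> \<alpha> * trimmed_cost (mset_set P) z O_star + \<beta> * \<xi> * L\<^sup>2"
    proof -
      have O: "finite O_star" "O_star \<noteq> {}" using k_pos by (auto simp: O_star_def lessThan_empty_iff)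
      have "card O_star \<le> k"
        unfolding O_star_def image_image using card_image_le[of "{..<k}"] by (metis card_lessThan finite_lessThan)
      then obtain M where M: "O_star \<subseteq> M" "finite M" "card M = k"
        using ex_finite_superset_card O(1) by blast
      have "(1 / real (n - z)) * V \<le> trimmed_cost (mset_set P) z M"
        unfolding V_def by (rule C_opt[OF M(2,3)])
      also have "\<dots> \<le> trimmed_cost (mset_set P) z O_star" by (rule trimmed_cost_antimono[OF M(1,2) O(2)])
      finally have opt: "(1 / real (n - z)) * V \<le> trimmed_cost (mset_set P) z O_star" .
      have "\<beta> \<ge> 0" unfolding \<beta>_def using c_ge t_gt delta by (intro mult_nonneg_nonneg) auto
      then have "(1 + \<beta>) * ((1 / real (n - z)) * V) \<le> (2 + \<beta>) * trimmed_cost (mset_set P) z O_star"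
        using opt V_nonneg by (intro mult_mono) auto
      then show ?thesis by (simp add: \<alpha>_def \<beta>_def)
    qed
    finally show ?thesis by (simp add: good_def H_def S_def)
  qed

  \<comment> \<open>Failure probabilities given few outliers\<close>
  have card_bad: "real (card (bad j)) \<le> \<eta> / (2 * real k) * real (card F)" if "j < k" for j
  proof -
    have "real (card (bad j)) \<le> exp (- (\<delta>\<^sup>2 * \<mu> j / 3)) * real (card F)"
      unfolding bad_def F_def \<mu>_def n_def using P_fin P_ne B C_sub[OF that] delta that
      by (intro card_few_hits_lower_tail) (auto simp: P_opt_def)
    also have "\<dots> \<le> exp (- l) * real (card F)"
    proof -
      \<comment> \<open>The first term of the sample size and \<open>sig1\<close> bring the Chernoff
        exponent \<open>\<delta>\<^sup>2 * \<mu> j / 3\<close> up to \<open>l\<close>.\<close>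
      have "l = \<delta>\<^sup>2 / 3 * ((3 * real k / (\<delta>\<^sup>2 * \<epsilon>1) * l) * (\<epsilon>1 / real k))"
        using delta eps1 k by simp
      also have "\<dots> \<le> \<delta>\<^sup>2 / 3 * (real m * (real (card (C j)) / real n))"
        using m_ge(1) sig1[OF that] n eps1 k
        by (intro mult_left_mono mult_mono) (auto simp: le_divide_eq)
      finally show ?thesis by (intro mult_right_mono) (auto simp: \<mu>_def)
    qed
    finally show ?thesis using exp_l by simp
  qed

  have card_badY: "real (card badY) \<le> \<eta> / 2 * real (card F)"
  proof -
    have "real (card badY) \<le> exp (- (\<delta> * a)) * real (card F)"
      unfolding badY_def F_def
    proof (rule card_few_hits_upper_tail)
      show "y x / L\<^sup>2 \<le> 1" for x using y_le[of x] by (simp add: divide_le_eq_1)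
      show "(\<Sum>x\<in>P - B. y x / L\<^sup>2) \<le> V' * real (card (P - B))"
        unfolding B(2) sum_divide_distrib[symmetric] V_eq[symmetric] V'_def P_opt_card using nz(2) by simp
    qed (use P_fin B delta y_nonneg y_out V_nonneg in \<open>auto simp: V'_def B_def\<close>)
    also have "\<dots> \<le> exp (- l) * real (card F)"
    proof -
      define K where "K = real k / \<epsilon>1 * l"
      have K: "K > 0" using k eps1 l by (simp add: K_def)
      \<comment> \<open>The two terms of the sample size each bound \<open>m\<close> below by a
        multiple of \<open>K\<close>. Multiplying both bounds yields
        \<open>K \<le> \<delta> * \<xi> * real m\<close>.\<close>
      have "K\<^sup>2 \<le> (3 / \<delta>\<^sup>2 * K) * (1 / (2 * \<xi>\<^sup>2 * (1 - \<delta>)) * K) * (\<delta> * \<xi>)\<^sup>2"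
      proof -
        have "(3 / \<delta>\<^sup>2 * K) * (1 / (2 * \<xi>\<^sup>2 * (1 - \<delta>)) * K) * (\<delta> * \<xi>)\<^sup>2 = 3 / (2 * (1 - \<delta>)) * K\<^sup>2"
          using delta xi by (simp add: field_simps power2_eq_square)
        moreover have "1 \<le> 3 / (2 * (1 - \<delta>))" using delta by (simp add: field_simps)
        then have "1 * K\<^sup>2 \<le> 3 / (2 * (1 - \<delta>)) * K\<^sup>2" by (intro mult_right_mono) auto
        ultimately show ?thesis by simp
      qed
      also have "\<dots> \<le> (real m * real m) * (\<delta> * \<xi>)\<^sup>2"
      proof (intro mult_right_mono mult_mono)
        show "3 / \<delta>\<^sup>2 * K \<le> real m" using m_ge(1) by (simp add: K_def)
        show "1 / (2 * \<xi>\<^sup>2 * (1 - \<delta>)) * K \<le> real m" using m_ge(2) by (simp add: K_def mult_ac)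
        show "0 \<le> 1 / (2 * \<xi>\<^sup>2 * (1 - \<delta>)) * K" using K delta by simp
      qed auto
      also have "\<dots> = (\<delta> * \<xi> * real m)\<^sup>2" by (simp add: power2_eq_square mult_ac)
      finally have K_le: "K \<le> \<delta> * \<xi> * real m"
        by (rule power2_le_imp_le) (use delta xi in simp)
      have "l \<le> 2 * (real k * l)" using k l by simp
      also have "\<dots> = 2 * (K * \<epsilon>1)" using eps1 by (simp add: K_def)
      also have "\<dots> \<le> 2 * ((\<delta> * \<xi> * real m) * (real (n - z) / real n))"
        using K_le nz_ge n eps1 K delta xi by (intro mult_left_mono mult_mono) (auto simp: le_divide_eq)
      also have "\<dots> \<le> (1 + \<delta>) * (2 * ((\<delta> * \<xi> * real m) * (real (n - z) / real n)))"
        using mult_right_mono[of 1 "1 + \<delta>" "2 * ((\<delta> * \<xi> * real m) * (real (n - z) / real n))"] delta xi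
        by simp
      also have "\<dots> = \<delta> * a" by (simp add: a_def)
      finally show ?thesis by (intro mult_right_mono) auto
    qed
    also have "\<dots> \<le> \<eta> / 2 * real (card F)"
    proof -
      have "\<eta> / (2 * real k) \<le> \<eta> / 2" using k eta by (intro divide_left_mono) auto
      then show ?thesis unfolding exp_l by (intro mult_right_mono) auto
    qed
    finally show ?thesis .
  qed

  have card_F: "real (card F) \<ge> (1 - \<eta>) * real n ^ m"
    unfolding F_def n_def
  proof (rule card_few_hits_ge)
    \<comment> \<open>\<open>z'\<close> is a floor, so \<open>z' + 1\<close> is at least the
      expected number of sampled outliers divided by \<eta>.\<close>
    have "(1 / \<eta>) * (\<epsilon>2 / real k) * real m \<le> real z' + 1"
      unfolding z'_def using eta eps2 by linarith
    then have "\<eta> * ((1 / \<eta>) * (\<epsilon>2 / real k) * real m) \<le> \<eta> * (real z' + 1)"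
      using eta by (intro mult_left_mono) auto
    moreover have "real m * real z / real n = \<epsilon>2 / real k * real m"
      unfolding sig2 using n by simp
    ultimately show "real m * real (card B) / real (card P) \<le> \<eta> * (real z' + 1)"
      using eta card_B by (simp add: n_def)
  qed (use P_fin P_ne B in auto)

  \<comment> \<open>Union bound\<close>
  have "F \<subseteq> (?\<Omega> \<inter> good) \<union> ((\<Union>j<k. bad j) \<union> badY)"
  proof
    fix f assume "f \<in> F"
    then have f: "f \<in> ?\<Omega>" "hits m B f \<le> z'" by (auto simp: F_def)
    show "f \<in> (?\<Omega> \<inter> good) \<union> ((\<Union>j<k. bad j) \<union> badY)"
    proof (rule ccontr)
      assume *: "f \<notin> (?\<Omega> \<inter> good) \<union> ((\<Union>j<k. bad j) \<union> badY)"
      then have "\<not> real (hits m (C j) f) < (1 - \<delta>) * \<mu> j" if "j < k" for j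
        using f that unfolding bad_def by blast
      moreover have "\<not> (\<Sum>i<m. y (f i) / L\<^sup>2) > (1 + \<delta>) * real m * V' + a"
        using f * unfolding badY_def by blast
      ultimately have "f \<in> good" using good[OF f] by (simp add: not_less)
      then show False using * f by blast
    qed
  qed
  moreover have "finite ((?\<Omega> \<inter> good) \<union> ((\<Union>j<k. bad j) \<union> badY))"
    using fin by (auto simp: bad_def badY_def)
  ultimately have "card F \<le> card ((?\<Omega> \<inter> good) \<union> ((\<Union>j<k. bad j) \<union> badY))" by (simp add: card_mono)
  also have "\<dots> \<le> card (?\<Omega> \<inter> good) + (card (\<Union>j<k. bad j) + card badY)"
    by (meson card_Un_le add_left_mono order_trans)
  also have "\<dots> \<le> card (?\<Omega> \<inter> good) + ((\<Sum>j<k. card (bad j)) + card badY)"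
    by (intro add_mono card_UN_le) auto
  finally have "real (card F) \<le> real (card (?\<Omega> \<inter> good)) + ((\<Sum>j<k. real (card (bad j))) + real (card badY))"
    by (simp flip: of_nat_sum of_nat_add)
  also have "\<dots> \<le> real (card (?\<Omega> \<inter> good)) + ((\<Sum>j<k. \<eta> / (2 * real k) * real (card F)) + \<eta> / 2 * real (card F))"
    using card_bad card_badY by (intro add_left_mono add_mono sum_mono) auto
  \<comment> \<open>The \<open>k\<close> clusters use up \<open>\<eta> / 2\<close>, and
    \<open>badY\<close> the other half.\<close>
  also have "\<dots> = real (card (?\<Omega> \<inter> good)) + \<eta> * real (card F)" using k by simp
  finally have "(1 - \<eta>) * real (card F) \<le> real (card (?\<Omega> \<inter> good))" by (simp add: left_diff_distrib)
  moreover have "(1 - \<eta>) * ((1 - \<eta>) * real n ^ m) \<le> (1 - \<eta>) * real (card F)"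
    using card_F eta by (intro mult_left_mono) auto
  ultimately have "(1 - \<eta>)\<^sup>2 * real n ^ m \<le> real (card (?\<Omega> \<inter> good))"
    by (simp add: power2_eq_square)
  \<comment> \<open>One factor \<open>1 - \<eta>\<close> comes from \<open>F\<close> and one from
    the failures inside \<open>F\<close>; the cube is a weakening.\<close>
  moreover have "(1 - \<eta>) ^ 3 \<le> (1 - \<eta>)\<^sup>2" using eta by (intro power_decreasing) auto
  then have "(1 - \<eta>) ^ 3 * real n ^ m \<le> (1 - \<eta>)\<^sup>2 * real n ^ m" by (intro mult_right_mono) auto
  ultimately have "(1 - \<eta>) ^ 3 * real n ^ m \<le> real (card (?\<Omega> \<inter> good))" by linarith
  then have "(1 - \<eta>) ^ 3 \<le> real (card (?\<Omega> \<inter> good)) / real n ^ m" using n by (simp add: le_divide_eq)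
  moreover have "measure_pmf.prob (pmf_of_set ?\<Omega>) good = real (card (?\<Omega> \<inter> good)) / real n ^ m"
    using fin P_ne by (subst measure_pmf_of_set) (auto simp: PiE_eq_empty_iff card_PiE n_def)
  ultimately show ?thesis by (simp add: good_def)
qed

end
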